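(* For every integer $r \geq 1$ and every positive integer $s$, the problem Vertex $r$-Triangle $s$-Club parameterized by $\mathsf{fes}$, the feedback edge number of the input graph, admits a kernel with at most $3\,\mathsf{fes}$ vertices and at most $4\,\mathsf{fes} - 1$ edges.
   Context: All graphs are finite, simple and undirected. A set $S \subseteq V(G)$ is an $s$-club if $G[S]$ has diameter at most $s$. A set $S$ satisfies the vertex $r$-triangle property if every $v \in S$ belongs to at least $r$ triangles of $G[S]$. Vertex $r$-Triangle $s$-Club: given a graph $G$ and an integer $\ell$, decide whether there is $S \subseteq V(G)$ with $|S| \geq \ell$ that is an $s$-club and satisfies the vertex $r$-triangle property. A feedback edge set of $G$ is $F \subseteq E(G)$ such that $G - F$ is a forest; $\mathsf{fes}(G)$ is the minimum size of a feedback edge set. A kernel is a polynomial-time algorithm that, given an instance $(G,\ell)$ with parameter $k=\mathsf{fes}(G)$, outputs an equivalent instance (a yes-instance iff the input is) whose graph has the stated size bounds in terms of $k$.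
   Formalization: For fes = 0 (the input graph is a forest) the bound 4 fes − 1 equals −1, which no graph can meet; there the edge bound is read as 0, and for fes ≥ 1 it is exactly 4 fes − 1. *)

theory Defs
  imports Main "HOL-Library.Extended_Nat"
begin

section \<open>Finite simple graphs\<close>

record 'a ugraph =
  verts :: "'a set"
  edges :: "'a set set"

definition simple_graph :: "'a ugraph \<Rightarrow> bool" where
  "simple_graph G \<longleftrightarrow>
     finite (verts G) \<and> (\<forall>e\<in>edges G. e \<subseteq> verts G \<and> card e = 2)"

definition induced :: "'a ugraph \<Rightarrow> 'a set \<Rightarrow> 'a ugraph" where
  "induced G S = \<lparr>verts = verts G \<inter> S, edges = {e \<in> edges G. e \<subseteq> S}\<rparr>"

definition delete_edges :: "'a ugraph \<Rightarrow> 'a set set \<Rightarrow> 'a ugraph" where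
  "delete_edges G F = \<lparr>verts = verts G, edges = edges G - F\<rparr>"

definition is_path :: "'a ugraph \<Rightarrow> 'a list \<Rightarrow> bool" where
  "is_path G xs \<longleftrightarrow> xs \<noteq> [] \<and> distinct xs \<and> set xs \<subseteq> verts G \<and>
     (\<forall>i. Suc i < length xs \<longrightarrow> {xs ! i, xs ! Suc i} \<in> edges G)"

definition is_cycle :: "'a ugraph \<Rightarrow> 'a list \<Rightarrow> bool" where
  "is_cycle G xs \<longleftrightarrow> 3 \<le> length xs \<and> is_path G xs \<and> {last xs, hd xs} \<in> edges G"

definition forest :: "'a ugraph \<Rightarrow> bool" where
  "forest G \<longleftrightarrow> (\<nexists>xs. is_cycle G xs)"

definition feedback_edge_set :: "'a ugraph \<Rightarrow> 'a set set \<Rightarrow> bool" where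
  "feedback_edge_set G F \<longleftrightarrow> F \<subseteq> edges G \<and> forest (delete_edges G F)"

definition fes :: "'a ugraph \<Rightarrow> nat" where
  "fes G = Min (card ` {F. feedback_edge_set G F})"

(* Vertices in different components have distance \<infinity>. *)
definition graph_dist :: "'a ugraph \<Rightarrow> 'a \<Rightarrow> 'a \<Rightarrow> enat" where
  "graph_dist G u v =
     (INF xs\<in>{xs. is_path G xs \<and> hd xs = u \<and> last xs = v}. enat (length xs - 1))"

(* The graph without vertices has diameter 0. *)
definition diam :: "'a ugraph \<Rightarrow> enat" where
  "diam G = (SUP (u, v)\<in>verts G \<times> verts G. graph_dist G u v)"

definition triangles :: "'a ugraph \<Rightarrow> 'a set set" where
  "triangles G = {T. T \<subseteq> verts G \<and> card T = 3 \<and>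
     (\<forall>u\<in>T. \<forall>v\<in>T. u \<noteq> v \<longrightarrow> {u, v} \<in> edges G)}"


section \<open>Vertex \<open>r\<close>-Triangle \<open>s\<close>-Club\<close>

definition s_club :: "nat \<Rightarrow> 'a ugraph \<Rightarrow> 'a set \<Rightarrow> bool" where
  "s_club s G S \<longleftrightarrow> S \<subseteq> verts G \<and> diam (induced G S) \<le> enat s"

definition vertex_triangle_property :: "nat \<Rightarrow> 'a ugraph \<Rightarrow> 'a set \<Rightarrow> bool" where
  "vertex_triangle_property r G S \<longleftrightarrow>
     (\<forall>v\<in>S. r \<le> card {T \<in> triangles (induced G S). v \<in> T})"

definition vertex_triangle_club :: "nat \<Rightarrow> nat \<Rightarrow> 'a ugraph \<Rightarrow> int \<Rightarrow> bool" where
  "vertex_triangle_club r s G l \<longleftrightarrow>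
     (\<exists>S \<subseteq> verts G. l \<le> int (card S) \<and> s_club s G S \<and> vertex_triangle_property r G S)"


section \<open>Algorithms and running time\<close>

text \<open>
  Algorithms are programs of a WHILE language over binary trees (after N. D. Jones,
  Computability and Complexity from a Programming Perspective). Evaluating an
  expression costs the total size of the values of all its subexpressions. Thus
  there is no free sharing of subtrees, every value occurring in a run is no
  larger than the time spent plus the input size, and polynomial time in this
  model coincides with polynomial time on Turing machines.
\<close>

datatype data = Leaf | Node data data

primrec dsize :: "data \<Rightarrow> nat" where
  "dsize Leaf = 1"
| "dsize (Node a b) = 1 + dsize a + dsize b"

datatype expr = Var nat | ENil | ECons expr expr | EHd expr | ETl expr | EEq expr expr

type_synonym store = "nat \<Rightarrow> data"

fun dhd :: "data \<Rightarrow> data" where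
  "dhd Leaf = Leaf"
| "dhd (Node a b) = a"

fun dtl :: "data \<Rightarrow> data" where
  "dtl Leaf = Leaf"
| "dtl (Node a b) = b"

(* Leaf is false, every other tree is true. *)
primrec eeval :: "expr \<Rightarrow> store \<Rightarrow> data" where
  "eeval (Var x) \<sigma> = \<sigma> x"
| "eeval ENil \<sigma> = Leaf"
| "eeval (ECons e f) \<sigma> = Node (eeval e \<sigma>) (eeval f \<sigma>)"
| "eeval (EHd e) \<sigma> = dhd (eeval e \<sigma>)"
| "eeval (ETl e) \<sigma> = dtl (eeval e \<sigma>)"
| "eeval (EEq e f) \<sigma> = (if eeval e \<sigma> = eeval f \<sigma> then Node Leaf Leaf else Leaf)"

primrec ecost :: "expr \<Rightarrow> store \<Rightarrow> nat" where
  "ecost (Var x) \<sigma> = dsize (\<sigma> x)"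
| "ecost ENil \<sigma> = 1"
| "ecost (ECons e f) \<sigma> = ecost e \<sigma> + ecost f \<sigma> + dsize (eeval (ECons e f) \<sigma>)"
| "ecost (EHd e) \<sigma> = ecost e \<sigma> + dsize (eeval (EHd e) \<sigma>)"
| "ecost (ETl e) \<sigma> = ecost e \<sigma> + dsize (eeval (ETl e) \<sigma>)"
| "ecost (EEq e f) \<sigma> = ecost e \<sigma> + ecost f \<sigma> + dsize (eeval (EEq e f) \<sigma>)"

datatype prog = Skip | Assign nat expr | Seq prog prog | Cond expr prog prog | While expr prog

(* exec p \<sigma> t \<tau>: started in \<sigma>, the program p stops after t steps in \<tau>. *)
inductive exec :: "prog \<Rightarrow> store \<Rightarrow> nat \<Rightarrow> store \<Rightarrow> bool" where
  Skip: "exec Skip \<sigma> 1 \<sigma>"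
| Assign: "exec (Assign x e) \<sigma> (1 + ecost e \<sigma>) (\<sigma>(x := eeval e \<sigma>))"
| Seq: "exec p \<sigma> t \<tau> \<Longrightarrow> exec q \<tau> u \<rho> \<Longrightarrow> exec (Seq p q) \<sigma> (t + u) \<rho>"
| CondTrue: "eeval e \<sigma> \<noteq> Leaf \<Longrightarrow> exec p \<sigma> t \<tau> \<Longrightarrow>
    exec (Cond e p q) \<sigma> (1 + ecost e \<sigma> + t) \<tau>"
| CondFalse: "eeval e \<sigma> = Leaf \<Longrightarrow> exec q \<sigma> t \<tau> \<Longrightarrow>
    exec (Cond e p q) \<sigma> (1 + ecost e \<sigma> + t) \<tau>"
| WhileFalse: "eeval e \<sigma> = Leaf \<Longrightarrow> exec (While e p) \<sigma> (1 + ecost e \<sigma>) \<sigma>"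
| WhileTrue: "eeval e \<sigma> \<noteq> Leaf \<Longrightarrow> exec p \<sigma> t \<tau> \<Longrightarrow> exec (While e p) \<tau> u \<rho> \<Longrightarrow>
    exec (While e p) \<sigma> (1 + ecost e \<sigma> + t + u) \<rho>"

inductive_cases SkipE: "exec Skip \<sigma> t \<tau>"
inductive_cases AssignE: "exec (Assign x e) \<sigma> t \<tau>"
inductive_cases SeqE: "exec (Seq p q) \<sigma> t \<tau>"
inductive_cases CondE: "exec (Cond e p q) \<sigma> t \<tau>"
inductive_cases WhileE: "exec (While e p) \<sigma> t \<tau>"

lemma exec_deterministic:
  "exec p \<sigma> t \<tau> \<Longrightarrow> exec p \<sigma> t' \<tau>' \<Longrightarrow> t' = t \<and> \<tau>' = \<tau>"
proof (induction arbitrary: t' \<tau>' rule: exec.induct)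
  case (Skip \<sigma>)
  then show ?case by (rule SkipE) simp
next
  case (Assign x e \<sigma>)
  then show ?case by (rule AssignE) simp
next
  case (Seq p \<sigma> t \<tau> q u \<rho>)
  from Seq.prems obtain t1 \<tau>1 u1 where
    "t' = t1 + u1" "exec p \<sigma> t1 \<tau>1" "exec q \<tau>1 u1 \<tau>'"
    by (rule SeqE)
  with Seq.IH show ?case by metis
next
  case (CondTrue e \<sigma> p t \<tau> q)
  from CondTrue.prems CondTrue.hyps(1) obtain t1 where
    "t' = 1 + ecost e \<sigma> + t1" "exec p \<sigma> t1 \<tau>'"
    by (elim CondE) auto
  with CondTrue.IH show ?case by metis
next
  case (CondFalse e \<sigma> q t \<tau> p)
  from CondFalse.prems CondFalse.hyps(1) obtain t1 where
    "t' = 1 + ecost e \<sigma> + t1" "exec q \<sigma> t1 \<tau>'"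
    by (elim CondE) auto
  with CondFalse.IH show ?case by metis
next
  case (WhileFalse e \<sigma> p)
  from WhileFalse.prems show ?case by (rule WhileE) (simp_all add: WhileFalse.hyps)
next
  case (WhileTrue e \<sigma> p t \<tau> u \<rho>)
  from WhileTrue.prems obtain t1 \<tau>1 u1 where
    "t' = 1 + ecost e \<sigma> + t1 + u1" "exec p \<sigma> t1 \<tau>1" "exec (While e p) \<tau>1 u1 \<tau>'"
    by (rule WhileE) (simp_all add: WhileTrue.hyps(1))
  with WhileTrue.IH show ?case by metis
qed

(* Input and output are held in variable 0; all other variables are initially Leaf. *)
definition runs :: "prog \<Rightarrow> data \<Rightarrow> nat \<Rightarrow> data \<Rightarrow> bool" where
  "runs p x t y \<longleftrightarrow> (\<exists>\<tau>. exec p ((\<lambda>_. Leaf)(0 := x)) t \<tau> \<and> \<tau> 0 = y)"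


section \<open>Encoding of instances\<close>

(* Binary, least significant bit first. *)
fun enc_nat :: "nat \<Rightarrow> data" where
  "enc_nat n = (if n = 0 then Leaf
     else Node (if odd n then Node Leaf Leaf else Leaf) (enc_nat (n div 2)))"

declare enc_nat.simps [simp del]

definition enc_int :: "int \<Rightarrow> data" where
  "enc_int l = Node (if l < 0 then Node Leaf Leaf else Leaf) (enc_nat (nat \<bar>l\<bar>))"

definition enc_edge :: "nat \<times> nat \<Rightarrow> data" where
  "enc_edge e = Node (enc_nat (fst e)) (enc_nat (snd e))"

definition enc_list :: "data list \<Rightarrow> data" where
  "enc_list xs = foldr Node xs Leaf"

(* An instance is given by a list of its vertices, a list of its edges and l.
   The lists are duplicate-free, in arbitrary order; each edge is listed
   in one of its two orientations. *)
definition encodes :: "data \<Rightarrow> nat ugraph \<Rightarrow> int \<Rightarrow> bool" where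
  "encodes x G l \<longleftrightarrow> (\<exists>vs es.
     distinct vs \<and> set vs = verts G \<and>
     distinct (map (\<lambda>(u, v). {u, v}) es) \<and> (\<lambda>(u, v). {u, v}) ` set es = edges G \<and>
     x = Node (enc_list (map enc_nat vs))
           (Node (enc_list (map enc_edge es)) (enc_int l)))"

lemma enc_nat_inject: "enc_nat m = enc_nat n \<longleftrightarrow> m = n"
proof
  show "enc_nat m = enc_nat n \<Longrightarrow> m = n"
  proof (induction m arbitrary: n rule: less_induct)
    case (less m)
    show ?case
    proof (cases "m = 0 \<or> n = 0")
      case True
      with less.prems show ?thesis
        by (auto simp: enc_nat.simps[of m] enc_nat.simps[of n] split: if_splits)
    next
      case False
      with less.prems have "odd m = odd n" "enc_nat (m div 2) = enc_nat (n div 2)"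
        by (auto simp: enc_nat.simps[of m] enc_nat.simps[of n] split: if_splits)
      with less.IH[of "m div 2" "n div 2"] False have "m div 2 = n div 2" "m mod 2 = n mod 2"
        by (auto simp: odd_iff_mod_2_eq_one)
      then show ?thesis by (metis div_mult_mod_eq)
    qed
  qed
qed simp

lemma enc_int_inject: "enc_int k = enc_int l \<longleftrightarrow> k = l"
  by (auto simp: enc_int_def enc_nat_inject split: if_splits)

lemma enc_edge_inject: "enc_edge e = enc_edge f \<longleftrightarrow> e = f"
  by (auto simp: enc_edge_def enc_nat_inject prod_eq_iff)

lemma enc_list_inject: "enc_list xs = enc_list ys \<longleftrightarrow> xs = ys"
proof (induction xs arbitrary: ys)
  case Nil
  then show ?case by (cases ys) (auto simp: enc_list_def)
next
  case (Cons x xs)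
  then show ?case by (cases ys) (auto simp: enc_list_def)
qed

lemma encodes_unique:
  assumes "encodes x G l" "encodes x H k"
  shows "G = H \<and> l = k"
proof -
  have inj: "inj enc_nat" "inj enc_edge"
    by (auto simp: inj_def enc_nat_inject enc_edge_inject)
  obtain vs es where 1: "set vs = verts G" "(\<lambda>(u, v). {u, v}) ` set es = edges G"
    "x = Node (enc_list (map enc_nat vs)) (Node (enc_list (map enc_edge es)) (enc_int l))"
    using assms(1) unfolding encodes_def by blast
  obtain ws fs where 2: "set ws = verts H" "(\<lambda>(u, v). {u, v}) ` set fs = edges H"
    "x = Node (enc_list (map enc_nat ws)) (Node (enc_list (map enc_edge fs)) (enc_int k))"
    using assms(2) unfolding encodes_def by blast
  have "vs = ws" "es = fs" "l = k"
    using 1(3) 2(3) inj by (simp_all add: enc_list_inject enc_int_inject inj_map_eq_map)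
  with 1 2 show ?thesis by (simp add: ugraph.equality)
qed


section \<open>Kernels\<close>

(* The problem Q with parameter \<kappa> has a kernel with at most f k vertices and
   at most g k edges, where k is the parameter of the input graph. *)
definition admits_kernel ::
  "(nat ugraph \<Rightarrow> int \<Rightarrow> bool) \<Rightarrow> (nat ugraph \<Rightarrow> nat) \<Rightarrow> (nat \<Rightarrow> nat) \<Rightarrow> (nat \<Rightarrow> nat) \<Rightarrow> bool"
where
  "admits_kernel Q \<kappa> f g \<longleftrightarrow> (\<exists>p c d. \<forall>G l x. simple_graph G \<and> encodes x G l \<longrightarrow>
     (\<exists>t y G' l'. runs p x t y \<and> t \<le> c * dsize x ^ d + c \<and>
        simple_graph G' \<and> encodes y G' l' \<and> (Q G' l' \<longleftrightarrow> Q G l) \<and>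
        card (verts G') \<le> f (\<kappa> G) \<and> card (edges G') \<le> g (\<kappa> G)))"

end

(* A solution consists of vertices lying in triangles, so deleting all other vertices keeps the
   answer. Let F be a feedback edge set of the remaining graph. Every triangle contains an edge of F,
   so a vertex that is no endpoint of F spans a triangle with some edge of F; two such vertices with
   the same edge would form a 4-cycle avoiding F. Hence there are at most 2|F| + |F| vertices, and the
   edges outside F form a forest, so they are fewer than the vertices. *)
theory Submission
  imports Defs
begin

section \<open>Graphs covered by triangles\<close>

text \<open>The feedback edge set occurs only in the analysis: the program computes neither one nor
  \<open>fes G\<close>. A minimum one of the input, restricted to the surviving edges, is a feedback
  edge set of the kernel, so the bounds hold in terms of the input's parameter. One round of
  deletion suffices, because the three corners of a triangle are kept together. Most of the length
  comes from the cost model, in which every evaluation pays for the sizes of all values involved.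
  Comparing a needle with each entry of a list is therefore quadratic, and two such lookups for
  every pair of a vertex and an edge give exponent 4. All time bounds are crude multiples of powers
  of a single number \<open>M\<close>, in the end three times the input size.\<close>

lemma forest_mono:
  "forest G \<Longrightarrow> verts H \<subseteq> verts G \<Longrightarrow> edges H \<subseteq> edges G \<Longrightarrow> forest H"
  unfolding forest_def is_cycle_def is_path_def by blast

lemma simple_graph_finite_edges: "simple_graph G \<Longrightarrow> finite (edges G)"
  unfolding simple_graph_def by (meson Pow_iff finite_Pow_iff finite_subset subsetI)

lemma simple_graph_induced: "simple_graph G \<Longrightarrow> simple_graph (induced G S)"
  by (auto simp: simple_graph_def induced_def)

lemma simple_graph_edgeE:
  assumes "simple_graph G" "e \<in> edges G" "v \<in> e"
  obtains u where "e = {v, u}" "u \<noteq> v" "u \<in> verts G"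
proof -
  have "card e = 2" "e \<subseteq> verts G"
    using assms by (auto simp: simple_graph_def)
  then show thesis
    using assms(3) that by (auto simp: card_2_iff)
qed

text \<open>The first vertex of a longest path works: a neighbour off the path would extend it, and
  a neighbour beyond the second vertex would close a cycle. Isolated vertices are allowed, hence
  \<open>\<le> 1\<close>.\<close>

lemma forest_ex_leaf:
  assumes G: "simple_graph G" "forest G" and ne: "verts G \<noteq> {}"
  shows "\<exists>v\<in>verts G. card {e \<in> edges G. v \<in> e} \<le> 1"
proof -
  have fin: "finite (verts G)"
    using G by (simp add: simple_graph_def)
  obtain v0 where "v0 \<in> verts G"
    using ne by blast
  then have "is_path G [v0]"
    by (simp add: is_path_def)
  moreover have "length xs \<le> card (verts G)" if "is_path G xs" for xs
    using that fin by (metis card_mono distinct_card is_path_def)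
  ultimately obtain xs where xs: "is_path G xs"
    and max: "\<And>ys. is_path G ys \<Longrightarrow> length ys \<le> length xs"
    using ex_has_greatest_nat[of "is_path G" "[v0]" length "Suc (card (verts G))"]
    by (metis less_Suc_eq_le)
  have dist: "distinct xs" "xs \<noteq> []" "set xs \<subseteq> verts G"
    and adj: "\<And>i. Suc i < length xs \<Longrightarrow> {xs ! i, xs ! Suc i} \<in> edges G"
    using xs by (auto simp: is_path_def)
  \<comment> \<open>On a path of one vertex \<open>xs ! 1\<close> is unspecified, but then there is
    no such \<open>e\<close>: the argument ends with 1 being an index below
    \<open>length xs\<close>.\<close>
  have "e = {hd xs, xs ! 1}" if e: "e \<in> edges G" "hd xs \<in> e" for e
  proof -
    obtain u where u: "e = {hd xs, u}" "u \<noteq> hd xs" "u \<in> verts G"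
      using simple_graph_edgeE[OF G(1) e] .
    have "u \<in> set xs"
    proof (rule ccontr)
      assume "u \<notin> set xs"
      then have "is_path G (u # xs)"
        using dist adj u e
        by (auto simp: is_path_def nth_Cons hd_conv_nth insert_commute split: nat.split)
      then show False
        using max by fastforce
    qed
    then obtain i where i: "i < length xs" "u = xs ! i"
      by (auto simp: in_set_conv_nth)
    have "i \<noteq> 0"
      using i u dist by (metis hd_conv_nth)
    moreover have "\<not> 2 \<le> i"
    proof
      assume "2 \<le> i"
      \<comment> \<open>The prefix ending in \<open>u\<close> is closed to a cycle by
        \<open>e\<close>; \<open>2 \<le> i\<close> provides the three vertices a cycle must
        have.\<close>
      have "is_path G (take (Suc i) xs)"
        using dist adj i by (auto simp: is_path_def dest: in_set_takeD)
      moreover have "last (take (Suc i) xs) = u" "hd (take (Suc i) xs) = hd xs"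
        using i dist(2) \<open>i \<noteq> 0\<close> by (simp_all add: take_Suc_conv_app_nth hd_append)
      ultimately have "is_cycle G (take (Suc i) xs)"
        using \<open>2 \<le> i\<close> i e u by (simp add: is_cycle_def insert_commute)
      then show False
        using G(2) by (auto simp: forest_def)
    qed
    ultimately have "i = 1"
      by simp
    then show ?thesis
      using u i by simp
  qed
  then have "{e \<in> edges G. hd xs \<in> e} \<subseteq> {{hd xs, xs ! 1}}"
    by blast
  then have "card {e \<in> edges G. hd xs \<in> e} \<le> 1"
    using card_mono[of "{{hd xs, xs ! 1}}"] by fastforce
  moreover have "hd xs \<in> verts G"
    using dist by auto
  ultimately show ?thesis
    by blast
qed

text \<open>Removing a vertex of degree at most one loses at most one edge and leaves a forest. The
  strict inequality fails for the empty graph, so the induction bottoms out at a single vertex, on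
  which no two-element edge fits.\<close>

lemma forest_card_edges:
  assumes "simple_graph G" "forest G" "verts G \<noteq> {}"
  shows "card (edges G) < card (verts G)"
  using assms
proof (induction "card (verts G)" arbitrary: G rule: less_induct)
  case less
  have fin: "finite (verts G)" "finite (edges G)"
    using less.prems(1) simple_graph_finite_edges by (auto simp: simple_graph_def)
  obtain v where v: "v \<in> verts G" "card {e \<in> edges G. v \<in> e} \<le> 1"
    using forest_ex_leaf less.prems by blast
  define H where "H = induced G (verts G - {v})"
  have H: "verts H = verts G - {v}" "edges H = {e \<in> edges G. v \<notin> e}"
    using less.prems(1) by (auto simp: H_def induced_def simple_graph_def)
  have "edges H \<union> {e \<in> edges G. v \<in> e} = edges G"
    by (auto simp: H)
  then have le: "card (edges G) \<le> card (edges H) + 1"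
    using v(2) card_Un_le[of "edges H" "{e \<in> edges G. v \<in> e}"] by simp
  have vH: "card (verts G) = Suc (card (verts H))"
    using v(1) fin by (metis H(1) card.remove)
  have sH: "simple_graph H"
    using less.prems(1) simple_graph_induced by (simp add: H_def)
  have "forest H"
    by (rule forest_mono[OF less.prems(2)]) (auto simp: H)
  show ?case
  proof (cases "verts H = {}")
    case True
    then have "verts G = {v}"
      using v(1) H(1) by blast
    then have "card e \<le> 1" if "e \<in> edges G" for e
      using that less.prems(1) card_mono[of "{v}" e] by (auto simp: simple_graph_def)
    then have "edges G = {}"
      using less.prems(1) by (fastforce simp: simple_graph_def)
    then show ?thesis
      using vH by simp
  next
    case False
    then have "card (edges H) < card (verts H)"
      using less.hyps \<open>forest H\<close> sH vH by simp
    then show ?thesis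
      using le vH by simp
  qed
qed

section \<open>Feedback edge sets of graphs whose vertices lie in triangles\<close>

lemma feedback_edge_set_hits_cycle3:
  assumes "feedback_edge_set G F" "distinct [a, b, c]" "{a, b, c} \<subseteq> verts G"
    "{a, b} \<in> edges G" "{b, c} \<in> edges G" "{a, c} \<in> edges G"
  shows "{a, b} \<in> F \<or> {b, c} \<in> F \<or> {a, c} \<in> F"
proof (rule ccontr)
  assume "\<not> ?thesis"
  then have "is_cycle (delete_edges G F) [a, b, c]"
    using assms by (auto simp: is_cycle_def is_path_def delete_edges_def nth_Cons insert_commute
        less_Suc_eq split: nat.split)
  then show False
    using assms(1) by (auto simp: feedback_edge_set_def forest_def)
qed

lemma feedback_edge_set_hits_cycle4:
  assumes "feedback_edge_set G F" "distinct [a, b, c, d]" "{a, b, c, d} \<subseteq> verts G"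
    "{a, b} \<in> edges G" "{b, c} \<in> edges G" "{c, d} \<in> edges G" "{a, d} \<in> edges G"
  shows "{a, b} \<in> F \<or> {b, c} \<in> F \<or> {c, d} \<in> F \<or> {a, d} \<in> F"
proof (rule ccontr)
  assume "\<not> ?thesis"
  then have "is_cycle (delete_edges G F) [a, b, c, d]"
    using assms by (auto simp: is_cycle_def is_path_def delete_edges_def nth_Cons insert_commute
        less_Suc_eq split: nat.split)
  then show False
    using assms(1) by (auto simp: feedback_edge_set_def forest_def)
qed

text \<open>Distinctness of the three corners is left to simplicity of the graph, which excludes
  loops. Stated through edges alone, the condition is one that adjacency lookups decide.\<close>

definition in_triangle :: "'a ugraph \<Rightarrow> 'a \<Rightarrow> bool" where
  "in_triangle G v \<longleftrightarrow> (\<exists>a b. {a, b} \<in> edges G \<and> {v, a} \<in> edges G \<and> {v, b} \<in> edges G)"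

lemma in_triangleI:
  assumes "T \<in> triangles G" "v \<in> T"
  shows "in_triangle G v"
proof -
  have "card T = 3"
    using assms by (simp add: triangles_def)
  then obtain a b where "a \<in> T" "b \<in> T" "a \<noteq> b" "v \<noteq> a" "v \<noteq> b"
    using assms(2) by (auto simp: card_3_iff)
  then show ?thesis
    using assms unfolding in_triangle_def triangles_def by blast
qed

lemma simple_graph_adjD:
  "simple_graph G \<Longrightarrow> {a, b} \<in> edges G \<Longrightarrow> a \<noteq> b \<and> a \<in> verts G \<and> b \<in> verts G"
  by (auto simp: simple_graph_def)

lemma card_verts_feedback_edge_set:
  assumes G: "simple_graph G" "feedback_edge_set G F"
    and tri: "\<And>v. v \<in> verts G \<Longrightarrow> in_triangle G v"
  shows "card (verts G) \<le> 3 * card F"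
proof -
  have F: "F \<subseteq> edges G" and finF: "finite F"
    using G simple_graph_finite_edges finite_subset by (auto simp: feedback_edge_set_def)
  have finV: "finite (verts G)"
    using G by (simp add: simple_graph_def)
  have "\<forall>e\<in>F. card e = 2"
    using F G(1) by (auto simp: simple_graph_def)
  then have ends: "card (\<Union>F) \<le> 2 * card F"
    using card_Union_le_sum_card[of F] by simp
  have "\<exists>f\<in>F. \<exists>a b. f = {a, b} \<and> a \<noteq> b \<and> {v, a} \<in> edges G \<and> {v, b} \<in> edges G"
    if v: "v \<in> verts G - \<Union>F" for v
  proof -
    obtain a b where ab: "{a, b} \<in> edges G" "{v, a} \<in> edges G" "{v, b} \<in> edges G"
      using tri[of v] v unfolding in_triangle_def by blast
    have dist: "distinct [v, a, b]" "{v, a, b} \<subseteq> verts G"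
      using ab simple_graph_adjD[OF G(1)] by auto
    \<comment> \<open>The two sides at \<open>v\<close> are not in \<open>F\<close> because
      \<open>v\<close> is no endpoint of it, so the opposite side must be.\<close>
    have "{a, b} \<in> F"
      using feedback_edge_set_hits_cycle3[OF G(2) dist ab(2,1,3)] v by auto
    then show ?thesis
      using ab dist by auto
  qed
  then obtain g where g: "\<And>v. v \<in> verts G - \<Union>F \<Longrightarrow>
      g v \<in> F \<and> (\<exists>a b. g v = {a, b} \<and> a \<noteq> b \<and> {v, a} \<in> edges G \<and> {v, b} \<in> edges G)"
    by metis
  have "inj_on g (verts G - \<Union>F)"
  proof (rule inj_onI, rule ccontr)
    fix v w
    assume v: "v \<in> verts G - \<Union>F" and w: "w \<in> verts G - \<Union>F" and eq: "g v = g w" and "v \<noteq> w"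
    obtain a b where ab: "g v = {a, b}" "a \<noteq> b" "{v, a} \<in> edges G" "{v, b} \<in> edges G"
      using g[OF v] by blast
    have wab: "{w, a} \<in> edges G" "{w, b} \<in> edges G"
      using g[OF w] ab(1) eq by (auto simp: doubleton_eq_iff)
    have dist: "distinct [v, a, w, b]" "{v, a, w, b} \<subseteq> verts G"
      using ab wab simple_graph_adjD[OF G(1)] \<open>v \<noteq> w\<close> by auto
    \<comment> \<open>On the cycle \<open>v, a, w, b\<close> every edge contains \<open>v\<close> or
      \<open>w\<close>, neither of which is an endpoint of an edge in \<open>F\<close>.\<close>
    show False
      using feedback_edge_set_hits_cycle4[OF G(2) dist] ab wab v w
      by (auto simp: insert_commute)
  qed
  then have "card (verts G - \<Union>F) \<le> card F"
    using g finF by (meson card_inj_on_le image_subsetI)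
  moreover have "card (verts G) \<le> card (verts G - \<Union>F) + card (\<Union>F)"
  proof -
    have "verts G - \<Union>F \<union> \<Union>F = verts G"
      using F G(1) by (auto simp: simple_graph_def)
    then show ?thesis
      using card_Un_le[of "verts G - \<Union>F" "\<Union>F"] by simp
  qed
  ultimately show ?thesis
    using ends by linarith
qed

lemma card_edges_feedback_edge_set:
  assumes G: "simple_graph G" "feedback_edge_set G F" "verts G \<noteq> {}"
  shows "card (edges G) < card (verts G) + card F"
proof -
  have F: "F \<subseteq> edges G" "finite F"
    using G simple_graph_finite_edges finite_subset by (auto simp: feedback_edge_set_def)
  have "simple_graph (delete_edges G F)"
    using G(1) by (auto simp: simple_graph_def delete_edges_def)
  then have "card (edges G - F) < card (verts G)"
    using forest_card_edges[of "delete_edges G F"] G by (simp add: delete_edges_def feedback_edge_set_def)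
  then show ?thesis
    using F by (simp add: card_Diff_subset)
qed

lemma fes_attained:
  assumes "simple_graph G"
  obtains F where "feedback_edge_set G F" "card F = fes G"
proof -
  \<comment> \<open>\<open>Min\<close> is meaningful only on a finite nonempty set; deleting all
    edges provides a member.\<close>
  have "feedback_edge_set G (edges G)"
    by (auto simp: feedback_edge_set_def forest_def delete_edges_def is_cycle_def)
  moreover have "finite {F. feedback_edge_set G F}"
    by (rule finite_subset[of _ "Pow (edges G)"])
      (use assms simple_graph_finite_edges in \<open>auto simp: feedback_edge_set_def\<close>)
  ultimately have "fes G \<in> card ` {F. feedback_edge_set G F}"
    unfolding fes_def by (intro Min_in) auto
  then show thesis
    using that by auto
qed

section \<open>The subgraph induced by the vertices in triangles\<close>

definition triangle_core :: "'a ugraph \<Rightarrow> 'a ugraph" where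
  "triangle_core G = induced G {v \<in> verts G. in_triangle G v}"

text \<open>A triangle of \<open>G\<close> through \<open>v\<close> witnesses
  \<open>in_triangle\<close> for its other two corners as well, so it survives the deletion whole
  and no second round of pruning arises.\<close>

lemma in_triangle_triangle_core:
  assumes "simple_graph G" "v \<in> verts (triangle_core G)"
  shows "in_triangle (triangle_core G) v"
proof -
  obtain a b where ab: "{a, b} \<in> edges G" "{v, a} \<in> edges G" "{v, b} \<in> edges G"
    using assms(2) by (auto simp: triangle_core_def induced_def in_triangle_def)
  then have "{b, a} \<in> edges G" "{a, v} \<in> edges G" "{b, v} \<in> edges G"
    by (simp_all add: insert_commute)
  with ab have "in_triangle G v" "in_triangle G a" "in_triangle G b"
    unfolding in_triangle_def by blast+
  then have "{a, b} \<in> edges (triangle_core G)" "{v, a} \<in> edges (triangle_core G)"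
    "{v, b} \<in> edges (triangle_core G)"
    using ab simple_graph_adjD[OF assms(1)] by (auto simp: triangle_core_def induced_def)
  then show ?thesis
    unfolding in_triangle_def by blast
qed

lemma triangle_core_size:
  assumes G: "simple_graph G"
  shows "card (verts (triangle_core G)) \<le> 3 * fes G"
    and "card (edges (triangle_core G)) \<le> 4 * fes G - 1"
proof -
  let ?H = "triangle_core G"
  have sub: "verts ?H \<subseteq> verts G" "edges ?H \<subseteq> edges G"
    by (auto simp: triangle_core_def induced_def)
  have H: "simple_graph ?H"
    using G simple_graph_induced by (simp add: triangle_core_def)
  obtain F where F: "feedback_edge_set G F" "card F = fes G"
    using fes_attained[OF G] .
  have "finite F"
    using F(1) G simple_graph_finite_edges finite_subset by (auto simp: feedback_edge_set_def)
  then have cF: "card (F \<inter> edges ?H) \<le> fes G"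
    using F(2) by (metis card_mono inf_le1)
  \<comment> \<open>The core without these edges is a subgraph of \<open>G\<close> without
    \<open>F\<close>, and subgraphs of forests are forests.\<close>
  have fH: "feedback_edge_set ?H (F \<inter> edges ?H)"
    using F(1) sub unfolding feedback_edge_set_def
    by (auto simp: delete_edges_def elim!: forest_mono)
  have v: "card (verts ?H) \<le> 3 * card (F \<inter> edges ?H)"
    using card_verts_feedback_edge_set[OF H fH] in_triangle_triangle_core[OF G] by blast
  then show "card (verts ?H) \<le> 3 * fes G"
    using cF by linarith
  show "card (edges ?H) \<le> 4 * fes G - 1"
  \<comment> \<open>The subtraction is truncated. An empty core has no edges; otherwise
    \<open>v\<close> forces the restricted set to be nonempty, and the strict bound for forests
    leaves fewer edges than (3 + 1) times its size.\<close>
  proof (cases "verts ?H = {}")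
    case True
    then have "edges ?H = {}"
      using H by (auto simp: simple_graph_def)
    then show ?thesis
      by simp
  next
    case False
    then show ?thesis
      using card_edges_feedback_edge_set[OF H fH] v cF by linarith
  qed
qed

text \<open>As \<open>r \<ge> 1\<close>, each vertex of a solution lies in a triangle of the induced
  subgraph, hence of \<open>G\<close>, so the solution lies inside the core. On such sets
  \<open>G\<close> and the core induce the same subgraph, which alone determines the diameter and
  the triangles.\<close>

lemma vertex_triangle_club_triangle_core:
  assumes "r \<ge> 1"
  shows "vertex_triangle_club r s (triangle_core G) l \<longleftrightarrow> vertex_triangle_club r s G l"
proof -
  let ?W = "{v \<in> verts G. in_triangle G v}"
  have ind: "induced (triangle_core G) S = induced G S" if "S \<subseteq> ?W" for S
    using that by (auto simp: triangle_core_def induced_def)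
  have sub: "S \<subseteq> ?W" if S: "S \<subseteq> verts G" "vertex_triangle_property r G S" for S
  proof
    fix v
    assume "v \<in> S"
    then have "card {T \<in> triangles (induced G S). v \<in> T} \<noteq> 0"
      using S(2) assms by (auto simp: vertex_triangle_property_def)
    then obtain T where "T \<in> triangles (induced G S)" "v \<in> T"
      by (metis (no_types, lifting) card.empty empty_Collect_eq)
    then have "in_triangle (induced G S) v"
      by (rule in_triangleI)
    then show "v \<in> ?W"
      using \<open>v \<in> S\<close> S(1) by (auto simp: in_triangle_def induced_def)
  qed
  have W: "verts (triangle_core G) = ?W"
    by (auto simp: triangle_core_def induced_def)
  have "s_club s (triangle_core G) S \<longleftrightarrow> s_club s G S"
    "vertex_triangle_property r (triangle_core G) S \<longleftrightarrow> vertex_triangle_property r G S"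
    if "S \<subseteq> ?W" for S
    using that ind[OF that] unfolding s_club_def vertex_triangle_property_def
    by (auto simp: W)
  then have "S \<subseteq> verts (triangle_core G) \<and> l \<le> int (card S) \<and> s_club s (triangle_core G) S
      \<and> vertex_triangle_property r (triangle_core G) S \<longleftrightarrow>
    S \<subseteq> verts G \<and> l \<le> int (card S) \<and> s_club s G S \<and> vertex_triangle_property r G S" for S
    using sub[of S] unfolding W by blast
  then show ?thesis
    unfolding vertex_triangle_club_def by (intro iff_exI)
qed

section \<open>Total correctness with time bounds\<close>

text \<open>Since \<open>exec\<close> is deterministic, one such run is the only run, so this is
  total correctness. An upper bound in place of the exact time permits rounding at every
  composition.\<close>

definition exec_within :: "prog \<Rightarrow> store \<Rightarrow> nat \<Rightarrow> (store \<Rightarrow> bool) \<Rightarrow> bool" where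
  "exec_within p \<sigma> T Q \<longleftrightarrow> (\<exists>t \<tau>. exec p \<sigma> t \<tau> \<and> t \<le> T \<and> Q \<tau>)"

lemma exec_withinI: "exec p \<sigma> t \<tau> \<Longrightarrow> t \<le> T \<Longrightarrow> Q \<tau> \<Longrightarrow> exec_within p \<sigma> T Q"
  unfolding exec_within_def by blast

lemma exec_within_mono:
  "exec_within p \<sigma> T Q \<Longrightarrow> T \<le> U \<Longrightarrow> (\<And>\<tau>. Q \<tau> \<Longrightarrow> R \<tau>) \<Longrightarrow> exec_within p \<sigma> U R"
  unfolding exec_within_def by (meson le_trans)

lemma exec_within_Skip: "Q \<sigma> \<Longrightarrow> 1 \<le> T \<Longrightarrow> exec_within Skip \<sigma> T Q"
  unfolding exec_within_def using exec.Skip by blast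

lemma exec_within_Assign:
  "ecost e \<sigma> < T \<Longrightarrow> Q (\<sigma>(x := eeval e \<sigma>)) \<Longrightarrow> exec_within (Assign x e) \<sigma> T Q"
  unfolding exec_within_def using exec.Assign[of x e \<sigma>] by fastforce

lemma exec_within_Seq:
  assumes "exec_within p \<sigma> T R" "\<And>\<tau>. R \<tau> \<Longrightarrow> exec_within q \<tau> U Q" "T + U \<le> V"
  shows "exec_within (Seq p q) \<sigma> V Q"
proof -
  obtain t \<tau> where 1: "exec p \<sigma> t \<tau>" "t \<le> T" "R \<tau>"
    using assms(1) by (auto simp: exec_within_def)
  obtain u \<rho> where 2: "exec q \<tau> u \<rho>" "u \<le> U" "Q \<rho>"
    using assms(2)[OF 1(3)] by (auto simp: exec_within_def)
  show ?thesis
    by (rule exec_withinI[where Q = Q, OF exec.Seq[OF 1(1) 2(1)]]) (use 1 2 assms(3) in auto)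
qed

text \<open>Here the intermediate condition pins down the whole store, so straight-line code is
  verified by computing updates.\<close>

lemma exec_within_Assign_Seq:
  assumes "ecost e \<sigma> < T" "exec_within p (\<sigma>(x := eeval e \<sigma>)) U Q" "T + U \<le> V"
  shows "exec_within (Seq (Assign x e) p) \<sigma> V Q"
  by (rule exec_within_Seq[where R = "\<lambda>\<tau>. \<tau> = \<sigma>(x := eeval e \<sigma>)" and T = T and U = U])
    (use assms in \<open>auto intro: exec_within_Assign\<close>)

lemma exec_within_Cond:
  assumes "eeval e \<sigma> \<noteq> Leaf \<Longrightarrow> exec_within p \<sigma> T Q"
    and "eeval e \<sigma> = Leaf \<Longrightarrow> exec_within q \<sigma> T Q"
    and "ecost e \<sigma> < U" "U + T \<le> V"
  shows "exec_within (Cond e p q) \<sigma> V Q"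
proof (cases "eeval e \<sigma> = Leaf")
  case True
  with assms(2) obtain t \<tau> where t: "exec q \<sigma> t \<tau>" "t \<le> T" "Q \<tau>"
    by (auto simp: exec_within_def)
  show ?thesis
    by (rule exec_withinI[where Q = Q, OF exec.CondFalse[OF True t(1)]]) (use t assms(3,4) in auto)
next
  case False
  with assms(1) obtain t \<tau> where t: "exec p \<sigma> t \<tau>" "t \<le> T" "Q \<tau>"
    by (auto simp: exec_within_def)
  show ?thesis
    by (rule exec_withinI[where Q = Q, OF exec.CondTrue[OF False t(1)]]) (use t assms(3,4) in auto)
qed

section \<open>Sizes of encoded lists, and loops over them\<close>

lemma enc_list_simps [simp]:
  "enc_list [] = Leaf" "enc_list (d # ds) = Node d (enc_list ds)"
  by (simp_all add: enc_list_def)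

lemma dsize_pos: "0 < dsize d"
  by (cases d) auto

lemma length_less_dsize_enc_list: "length ds < dsize (enc_list ds)"
  by (induction ds) auto

lemma dsize_enc_list_mem: "d \<in> set ds \<Longrightarrow> dsize d < dsize (enc_list ds)"
  by (induction ds) auto

text \<open>Each encoding ends in a \<open>Leaf\<close> of size 1, and concatenation keeps only one
  of the two.\<close>

lemma dsize_enc_list_append: "dsize (enc_list (ds @ es)) + 1 = dsize (enc_list ds) + dsize (enc_list es)"
  by (induction ds) auto

lemma dsize_enc_list_rev: "dsize (enc_list (rev ds)) = dsize (enc_list ds)"
proof (induction ds)
  case (Cons d ds)
  then show ?case
    using dsize_enc_list_append[of "rev ds" "[d]"] by simp
qed simp

lemma dsize_enc_list_filter: "dsize (enc_list (filter P ds)) \<le> dsize (enc_list ds)"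
  by (induction ds) auto

text \<open>The empty list is \<open>Leaf\<close> and every other list a \<open>Node\<close>, so the
  test asks whether entries are left, whatever their values. The list in \<open>l\<close> is
  consumed.\<close>

definition for_each :: "nat \<Rightarrow> nat \<Rightarrow> prog \<Rightarrow> prog" where
  "for_each l y p =
     While (Var l) (Seq (Assign y (EHd (Var l))) (Seq (Assign l (ETl (Var l))) p))"

text \<open>The invariant speaks of the processed prefix while \<open>l\<close> holds the rest,
  which is what the induction over the rest generalizes. Loop control reads \<open>l\<close> three
  times per round and produces one head and one tail, less than \<open>8 * M\<close> in all; the
  final, failing test costs 2.\<close>

lemma exec_within_for_each_aux:
  assumes "l \<noteq> y"
    and "\<And>pre d post \<sigma>. ds = pre @ d # post \<Longrightarrow> I pre \<sigma> \<Longrightarrow> 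
      exec_within p (\<sigma>(y := d, l := enc_list post)) T (\<lambda>\<tau>. I (pre @ [d]) \<tau> \<and> \<tau> l = enc_list post)"
    and "I pre \<sigma>" "\<sigma> l = enc_list post" "ds = pre @ post" "dsize (enc_list ds) \<le> M"
  shows "exec_within (for_each l y p) \<sigma> (length post * (T + 8 * M) + 2) (\<lambda>\<tau>. I ds \<tau> \<and> \<tau> l = Leaf)"
  using assms(3-)
proof (induction post arbitrary: pre \<sigma>)
  case Nil
  have "exec (for_each l y p) \<sigma> 2 \<sigma>"
    using exec.WhileFalse[of "Var l" \<sigma>] Nil by (simp add: for_each_def numeral_2_eq_2)
  then show ?case
    using Nil by (intro exec_withinI) auto
next
  case (Cons d post)
  let ?body = "Seq (Assign y (EHd (Var l))) (Seq (Assign l (ETl (Var l))) p)"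
  obtain t \<tau> where t: "exec p (\<sigma>(y := d, l := enc_list post)) t \<tau>" "t \<le> T"
    "I (pre @ [d]) \<tau>" "\<tau> l = enc_list post"
    using assms(2)[of pre d post \<sigma>] Cons.prems by (auto simp: exec_within_def)
  obtain u \<rho> where u: "exec (for_each l y p) \<tau> u \<rho>" "u \<le> length post * (T + 8 * M) + 2"
    "I ds \<rho>" "\<rho> l = Leaf"
    using Cons.IH[OF t(3,4)] Cons.prems by (auto simp: exec_within_def)
  define s where "s = dsize (\<sigma> l)"
  have s: "s = 1 + dsize d + dsize (enc_list post)" "s \<le> M"
    using Cons.prems dsize_enc_list_append[of pre "d # post"] dsize_pos[of "enc_list pre"]
    by (auto simp: s_def)
  have "exec (Assign y (EHd (Var l))) \<sigma> (1 + ecost (EHd (Var l)) \<sigma>) (\<sigma>(y := d))"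
    using exec.Assign[of y "EHd (Var l)" \<sigma>] Cons.prems(2) by simp
  moreover have "exec (Assign l (ETl (Var l))) (\<sigma>(y := d)) (1 + ecost (ETl (Var l)) (\<sigma>(y := d)))
      (\<sigma>(y := d, l := enc_list post))"
    using exec.Assign[of l "ETl (Var l)" "\<sigma>(y := d)"] Cons.prems(2) assms(1) by simp
  ultimately have "exec ?body \<sigma> (1 + ecost (EHd (Var l)) \<sigma> +
      (1 + ecost (ETl (Var l)) (\<sigma>(y := d)) + t)) \<tau>"
    using t(1) by (intro exec.Seq)
  then have "exec (for_each l y p) \<sigma> (1 + ecost (Var l) \<sigma> + (1 + ecost (EHd (Var l)) \<sigma> +
      (1 + ecost (ETl (Var l)) (\<sigma>(y := d)) + t)) + u) \<rho>"
    using Cons.prems(2) u(1) unfolding for_each_def by (intro exec.WhileTrue) auto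
  moreover have "1 + ecost (Var l) \<sigma> + (1 + ecost (EHd (Var l)) \<sigma> +
      (1 + ecost (ETl (Var l)) (\<sigma>(y := d)) + t)) + u \<le> length (d # post) * (T + 8 * M) + 2"
    using t(2) u(2) s Cons.prems(2) assms(1) dsize_pos[of d] by (simp add: s_def)
  ultimately show ?case
    using u unfolding exec_within_def by blast
qed

lemma exec_within_for_each:
  assumes "l \<noteq> y"
    and "\<And>pre d post \<sigma>. ds = pre @ d # post \<Longrightarrow> I pre \<sigma> \<Longrightarrow> 
      exec_within p (\<sigma>(y := d, l := enc_list post)) T (\<lambda>\<tau>. I (pre @ [d]) \<tau> \<and> \<tau> l = enc_list post)"
    and "I [] \<sigma>" "\<sigma> l = enc_list ds" "dsize (enc_list ds) \<le> M" "M * (T + 8 * M) \<le> U"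
    and "\<And>\<tau>. I ds \<tau> \<Longrightarrow> \<tau> l = Leaf \<Longrightarrow> Q \<tau>"
  shows "exec_within (for_each l y p) \<sigma> U Q"
proof (rule exec_within_mono[OF exec_within_for_each_aux
      [where post = ds and pre = "[]" and ds = ds and M = M and T = T and I = I]])
  \<comment> \<open>An encoded list is larger than its length, so \<open>M\<close> allows one extra
    round, which pays for the failing test.\<close>
  have "Suc (length ds) \<le> M"
    using length_less_dsize_enc_list[of ds] assms(5) by linarith
  then have "Suc (length ds) * (T + 8 * M) \<le> M * (T + 8 * M)"
    by (rule mult_le_mono1)
  then show "length ds * (T + 8 * M) + 2 \<le> U"
    using assms(6) \<open>Suc (length ds) \<le> M\<close> by simp
qed (use assms in auto)

section \<open>The program\<close>

text \<open>
  Variables: 0 input and output; 1, 2 iterated vertex list and current vertex; 3, 4 iterated edge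
  list and current edge; 13, 5, 6, 7 needle, iterated list, current element and result of a
  membership test; 8 all edges in both orientations; 9 whether vertex 2 lies in a triangle;
  10, 11 vertices and edges kept. Numbers are only compared for equality, hence treated as
  uninterpreted trees. In the time bounds \<open>M\<close> bounds every value occurring in the run.
\<close>

definition bool_data :: "bool \<Rightarrow> data" where
  "bool_data b = (if b then Node Leaf Leaf else Leaf)"

text \<open>The scan does not stop at a hit. After its initial reset the flag in variable 7 is only
  ever raised, so it always tells whether the needle occurs in the prefix read so far.\<close>

definition mem_prog :: prog where
  "mem_prog = Seq (Assign 7 ENil)
     (for_each 5 6 (Cond (EEq (Var 6) (Var 13)) (Assign 7 (ECons ENil ENil)) Skip))"

lemma exec_within_mem_prog:
  assumes "\<sigma> 5 = enc_list ds" "dsize (enc_list ds) \<le> M" "dsize (\<sigma> 13) \<le> M" "22 * M\<^sup>2 \<le> U"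
  shows "exec_within mem_prog \<sigma> U
    (\<lambda>\<tau>. \<tau> 7 = bool_data (\<sigma> 13 \<in> set ds) \<and> (\<forall>z. z \<notin> {5, 6, 7} \<longrightarrow> \<tau> z = \<sigma> z))"
  unfolding mem_prog_def
\<comment> \<open>At most \<open>M\<close> rounds cost \<open>12 * M\<close> for comparison and flag
  plus \<open>8 * M\<close> for loop control; the remaining 2 of the 22 covers the reset.\<close>
proof (rule exec_within_Assign_Seq[where T = "2" and U = "M * (12 * M + 8 * M)"])
  have "1 \<le> M"
    using assms(2) dsize_pos[of "enc_list ds"] by linarith
  then have "1 \<le> M * M"
    by simp
  moreover have "M * (12 * M + 8 * M) = 20 * (M * M)" "22 * M\<^sup>2 = 22 * (M * M)"
    by (simp_all add: power2_eq_square)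
  ultimately show "2 + M * (12 * M + 8 * M) \<le> U"
    using assms(4) by linarith
  let ?\<sigma> = "\<sigma>(7 := eeval ENil \<sigma>)"
  show "exec_within (for_each 5 6 (Cond (EEq (Var 6) (Var 13)) (Assign 7 (ECons ENil ENil)) Skip))
      ?\<sigma> (M * (12 * M + 8 * M))
      (\<lambda>\<tau>. \<tau> 7 = bool_data (\<sigma> 13 \<in> set ds) \<and> (\<forall>z. z \<notin> {5, 6, 7} \<longrightarrow> \<tau> z = \<sigma> z))"
  proof (rule exec_within_for_each[where ds = ds and M = M and T = "12 * M" and
        I = "\<lambda>pre \<tau>. \<tau> 7 = bool_data (\<sigma> 13 \<in> set pre) \<and> (\<forall>z. z \<notin> {5, 6, 7} \<longrightarrow> \<tau> z = \<sigma> z)"])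
    fix pre d post \<tau>
    assume ds: "ds = pre @ d # post"
      and I: "\<tau> 7 = bool_data (\<sigma> 13 \<in> set pre) \<and> (\<forall>z. z \<notin> {5, 6, 7} \<longrightarrow> \<tau> z = \<sigma> z)"
    have "dsize d < M"
      using dsize_enc_list_mem[of d ds] ds assms(2) by simp
    then show "exec_within (Cond (EEq (Var 6) (Var 13)) (Assign 7 (ECons ENil ENil)) Skip)
      (\<tau>(6 := d, 5 := enc_list post)) (12 * M) (\<lambda>\<tau>. (\<tau> 7 = bool_data (\<sigma> 13 \<in> set (pre @ [d])) \<and>
        (\<forall>z. z \<notin> {5, 6, 7} \<longrightarrow> \<tau> z = \<sigma> z)) \<and> \<tau> 5 = enc_list post)"
      using I assms(3) \<open>1 \<le> M\<close>
      by (intro exec_within_Cond[where T = "6" and U = "2 * M + 4"] exec_within_Assign exec_within_Skip)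
        (auto simp: bool_data_def split: if_splits)
  qed (use assms in \<open>auto simp: bool_data_def\<close>)
qed simp

definition if_mem :: "expr \<Rightarrow> nat \<Rightarrow> prog \<Rightarrow> prog" where
  "if_mem e l p = Seq (Assign 13 e) (Seq (Assign 5 (Var l)) (Seq mem_prog (Cond (Var 7) p Skip)))"

text \<open>The list is copied to variable 5 because the scan consumes it. The continuation is
  verified from every store that agrees with \<open>\<sigma>\<close> outside the scratch variables,
  so calls can be nested. Besides the scan itself, \<open>40 * M\<^sup>2\<close> covers the linear
  cost of setting it up.\<close>

lemma exec_within_if_mem:
  assumes "\<sigma> l = enc_list ds" "dsize (enc_list ds) \<le> M"
    and "ecost e \<sigma> < 3 * M" "dsize (eeval e \<sigma>) \<le> M"
    and l: "l \<notin> {5, 6, 7, 13}"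
    and p: "\<And>\<tau>. \<forall>z. z \<notin> {5, 6, 7, 13} \<longrightarrow> \<tau> z = \<sigma> z \<Longrightarrow> eeval e \<sigma> \<in> set ds \<Longrightarrow> exec_within p \<tau> T Q"
    and skip: "\<And>\<tau>. \<forall>z. z \<notin> {5, 6, 7, 13} \<longrightarrow> \<tau> z = \<sigma> z \<Longrightarrow> eeval e \<sigma> \<notin> set ds \<Longrightarrow> Q \<tau>"
    and "1 \<le> T" "40 * M\<^sup>2 + T \<le> U"
  shows "exec_within (if_mem e l p) \<sigma> U Q"
proof -
  let ?\<sigma> = "\<sigma>(13 := eeval e \<sigma>, 5 := enc_list ds)"
  have M: "1 \<le> M" "M \<le> M\<^sup>2"
    using assms(2) dsize_pos[of "enc_list ds"] by (auto simp: power2_eq_square)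
  have "exec_within mem_prog ?\<sigma> (22 * M\<^sup>2) (\<lambda>\<tau>. \<tau> 7 = bool_data (?\<sigma> 13 \<in> set ds) \<and>
      (\<forall>z. z \<notin> {5, 6, 7} \<longrightarrow> \<tau> z = ?\<sigma> z))"
    by (rule exec_within_mem_prog[where M = M]) (use assms in auto)
  then have "exec_within (Seq mem_prog (Cond (Var 7) p Skip)) ?\<sigma> (22 * M\<^sup>2 + (4 + T)) Q"
  proof (rule exec_within_Seq)
    fix \<tau>
    assume \<tau>: "\<tau> 7 = bool_data (?\<sigma> 13 \<in> set ds) \<and> (\<forall>z. z \<notin> {5, 6, 7} \<longrightarrow> \<tau> z = ?\<sigma> z)"
    then have frame: "\<forall>z. z \<notin> {5, 6, 7, 13} \<longrightarrow> \<tau> z = \<sigma> z"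
      by auto
    show "exec_within (Cond (Var 7) p Skip) \<tau> (4 + T) Q"
      by (rule exec_within_Cond[where T = T and U = 4])
        (use \<tau> p[OF frame] skip[OF frame] \<open>1 \<le> T\<close> in
          \<open>auto simp: bool_data_def intro: exec_within_Skip split: if_splits\<close>)
  qed simp
  then have "exec_within (Seq (Assign 5 (Var l)) (Seq mem_prog (Cond (Var 7) p Skip)))
      (\<sigma>(13 := eeval e \<sigma>)) (M + 1 + (22 * M\<^sup>2 + (4 + T))) Q"
    by (intro exec_within_Assign_Seq[where T = "M + 1" and U = "22 * M\<^sup>2 + (4 + T)"])
      (use assms(1,2) l in auto)
  then show ?thesis
    unfolding if_mem_def
    by (rule exec_within_Assign_Seq[OF assms(3)]) (use assms M in linarith)
qed

section \<open>Listing every edge in both orientations\<close>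

definition swap_data :: "data \<Rightarrow> data" where
  "swap_data d = Node (dtl d) (dhd d)"

text \<open>An instance lists each edge in one orientation only; with both present, adjacency
  becomes a single lookup.\<close>

definition sym_list :: "data list \<Rightarrow> data list" where
  "sym_list ds = concat (map (\<lambda>d. [d, swap_data d]) ds)"

definition sym_prog :: prog where
  "sym_prog = Seq (Assign 3 (EHd (ETl (Var 0)))) (for_each 3 4
     (Seq (Assign 8 (ECons (Var 4) (Var 8)))
       (Assign 8 (ECons (ECons (ETl (Var 4)) (EHd (Var 4))) (Var 8)))))"

lemma sym_list_simps [simp]:
  "sym_list [] = []" "sym_list (d # ds) = d # swap_data d # sym_list ds"
  "sym_list (ds @ es) = sym_list ds @ sym_list es"
  by (simp_all add: sym_list_def)

lemma set_sym_list: "set (sym_list ds) = set ds \<union> swap_data ` set ds"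
  by (auto simp: sym_list_def)

text \<open>Swapping preserves the size of a \<open>Node\<close> but turns \<open>Leaf\<close> into
  the larger \<open>Node Leaf Leaf\<close>, which the factor 2 would not cover. Encoded edges are
  always nodes.\<close>

lemma dsize_sym_list:
  "Leaf \<notin> set ds \<Longrightarrow> dsize (enc_list (sym_list ds)) \<le> 2 * dsize (enc_list ds)"
proof (induction ds)
  case (Cons d ds)
  then show ?case
    by (cases d) (auto simp: swap_data_def)
qed simp

lemma dsize_dhd: "dsize (dhd d) \<le> dsize d" and dsize_dtl: "dsize (dtl d) \<le> dsize d"
  by (cases d; simp)+

text \<open>Entries are put in front of the accumulator, hence \<open>rev\<close>. The factor 3 in
  \<open>M\<close> makes room for the accumulator, at most twice the edge list, together with the
  current edge.\<close>

lemma exec_within_sym_prog: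
  assumes \<sigma>: "\<sigma> 0 = Node V (Node (enc_list es) l)" "\<sigma> 8 = Leaf"
    and M: "3 * dsize (\<sigma> 0) \<le> M" and es: "Leaf \<notin> set es"
  shows "exec_within sym_prog \<sigma> (30 * M\<^sup>2)
    (\<lambda>\<tau>. \<tau> 8 = enc_list (rev (sym_list es)) \<and> (\<forall>z. z \<notin> {3, 4, 8} \<longrightarrow> \<tau> z = \<sigma> z))"
  unfolding sym_prog_def
proof (rule exec_within_Assign_Seq[where T = "3 * M" and U = "M * (12 * M + 8 * M)"])
  have sz: "3 * dsize (enc_list es) + 3 * dsize V + 3 * dsize l + 6 \<le> M"
    using M \<sigma>(1) by simp
  show "ecost (EHd (ETl (Var 0))) \<sigma> < 3 * M"
    using sz \<sigma>(1) by simp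
  have "M \<le> M\<^sup>2"
    by (simp add: power2_eq_square)
  moreover have "M * (12 * M + 8 * M) = 20 * M\<^sup>2"
    by (simp add: power2_eq_square)
  ultimately show "3 * M + M * (12 * M + 8 * M) \<le> 30 * M\<^sup>2"
    by linarith
  show "exec_within (for_each 3 4 (Seq (Assign 8 (ECons (Var 4) (Var 8)))
       (Assign 8 (ECons (ECons (ETl (Var 4)) (EHd (Var 4))) (Var 8)))))
     (\<sigma>(3 := eeval (EHd (ETl (Var 0))) \<sigma>)) (M * (12 * M + 8 * M))
    (\<lambda>\<tau>. \<tau> 8 = enc_list (rev (sym_list es)) \<and> (\<forall>z. z \<notin> {3, 4, 8} \<longrightarrow> \<tau> z = \<sigma> z))"
  proof (rule exec_within_for_each[where ds = es and M = M and T = "12 * M" and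
        I = "\<lambda>pre \<tau>. \<tau> 8 = enc_list (rev (sym_list pre)) \<and> (\<forall>z. z \<notin> {3, 4, 8} \<longrightarrow> \<tau> z = \<sigma> z)"])
    fix pre d post \<tau>
    assume ds: "es = pre @ d # post"
      and I: "\<tau> 8 = enc_list (rev (sym_list pre)) \<and> (\<forall>z. z \<notin> {3, 4, 8} \<longrightarrow> \<tau> z = \<sigma> z)"
    have d: "dsize d < dsize (enc_list es)" "dsize (dhd d) \<le> dsize d" "dsize (dtl d) \<le> dsize d"
      using dsize_enc_list_mem[of d es] ds by (auto simp: dsize_dhd dsize_dtl)
    have "dsize (enc_list (rev (sym_list pre))) \<le> 2 * dsize (enc_list pre)"
      using dsize_sym_list[of pre] ds es by (simp add: dsize_enc_list_rev)
    moreover have "dsize (enc_list pre) \<le> dsize (enc_list es)"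
      using dsize_enc_list_append[of pre "d # post"] ds by simp
    ultimately have acc: "dsize (enc_list (rev (sym_list pre))) \<le> 2 * dsize (enc_list es)"
      by linarith
    show "exec_within (Seq (Assign 8 (ECons (Var 4) (Var 8)))
        (Assign 8 (ECons (ECons (ETl (Var 4)) (EHd (Var 4))) (Var 8))))
      (\<tau>(4 := d, 3 := enc_list post)) (12 * M) (\<lambda>\<tau>. (\<tau> 8 = enc_list (rev (sym_list (pre @ [d]))) \<and>
        (\<forall>z. z \<notin> {3, 4, 8} \<longrightarrow> \<tau> z = \<sigma> z)) \<and> \<tau> 3 = enc_list post)"
      by (intro exec_within_Assign_Seq[where T = "3 * M" and U = "9 * M"] exec_within_Assign)
        (use I d acc sz in \<open>simp_all add: swap_data_def\<close>)
  qed (use \<sigma> sz in auto)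
qed

section \<open>The triangle test\<close>

definition tri_test :: "data list \<Rightarrow> data \<Rightarrow> bool" where
  "tri_test es v \<longleftrightarrow> (\<exists>e\<in>set es. Node v (dhd e) \<in> set (sym_list es) \<and> Node v (dtl e) \<in> set (sym_list es))"

text \<open>The side opposite the vertex in variable 2 is the edge being iterated, so only the two
  sides at that vertex have to be looked up.\<close>

definition tri_prog :: prog where
  "tri_prog = Seq (Assign 9 ENil) (Seq (Assign 3 (EHd (ETl (Var 0)))) (for_each 3 4
     (if_mem (ECons (Var 2) (EHd (Var 4))) 8 (if_mem (ECons (Var 2) (ETl (Var 4))) 8
       (Assign 9 (ECons ENil ENil))))))"

text \<open>The bound on \<open>\<sigma> 2\<close> keeps the needles, which pair this vertex with an
  end of an edge, within \<open>M\<close>.\<close>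

lemma exec_within_tri_prog:
  assumes \<sigma>: "\<sigma> 0 = Node V (Node (enc_list es) l)" "\<sigma> 8 = enc_list (rev (sym_list es))"
    and M: "3 * dsize (\<sigma> 0) \<le> M" and v: "dsize (\<sigma> 2) \<le> dsize V" and es: "Leaf \<notin> set es"
  shows "exec_within tri_prog \<sigma> (100 * M ^ 3) (\<lambda>\<tau>. \<tau> 9 = bool_data (tri_test es (\<sigma> 2)) \<and>
    (\<forall>z. z \<notin> {3, 4, 5, 6, 7, 9, 13} \<longrightarrow> \<tau> z = \<sigma> z))"
proof -
  have sz: "3 * dsize (enc_list es) + 3 * dsize V + 3 * dsize l + 6 \<le> M"
    using M \<sigma>(1) by simp
  have sz8: "dsize (enc_list (rev (sym_list es))) \<le> M"
    using sz dsize_sym_list[OF es] by (simp add: dsize_enc_list_rev)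
  have Mpow: "M \<le> M\<^sup>2" "M\<^sup>2 \<le> M ^ 3"
    using sz by (simp_all add: power2_eq_square power3_eq_cube)
  define body where "body = if_mem (ECons (Var 2) (EHd (Var 4))) 8
    (if_mem (ECons (Var 2) (ETl (Var 4))) 8 (Assign 9 (ECons ENil ENil)))"
  define I where "I = (\<lambda>pre \<tau>. \<tau> 9 = bool_data (\<exists>e\<in>set pre. Node (\<sigma> 2) (dhd e) \<in> set (sym_list es) \<and>
      Node (\<sigma> 2) (dtl e) \<in> set (sym_list es)) \<and> (\<forall>z. z \<notin> {3, 4, 5, 6, 7, 9, 13} \<longrightarrow> \<tau> z = \<sigma> z))"
  have loop: "exec_within (for_each 3 4 body) (\<sigma>(9 := Leaf, 3 := enc_list es))
    (M * (86 * M\<^sup>2 + 8 * M)) (I es)"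
  proof (rule exec_within_for_each[where ds = es and M = M and T = "86 * M\<^sup>2" and I = I])
    fix pre d post \<tau>
    assume ds: "es = pre @ d # post" and I: "I pre \<tau>"
    let ?\<tau> = "\<tau>(4 := d, 3 := enc_list post)"
    have d: "dsize d < dsize (enc_list es)" "dsize (dhd d) \<le> dsize d" "dsize (dtl d) \<le> dsize d"
      using dsize_enc_list_mem[of d es] ds by (auto simp: dsize_dhd dsize_dtl)
    show "exec_within body ?\<tau> (86 * M\<^sup>2) (\<lambda>\<tau>. I (pre @ [d]) \<tau> \<and> \<tau> 3 = enc_list post)"
      unfolding body_def
    \<comment> \<open>Two nested lookups at \<open>40 * M\<^sup>2\<close> each, and at most
      \<open>6 * M\<^sup>2\<close> for raising the flag, make up
      \<open>86 * M\<^sup>2\<close>.\<close>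
    proof (rule exec_within_if_mem[where M = M and T = "46 * M\<^sup>2" and ds = "rev (sym_list es)"])
      fix \<rho>
      assume \<rho>: "\<forall>z. z \<notin> {5, 6, 7, 13} \<longrightarrow> \<rho> z = ?\<tau> z"
        and mem: "eeval (ECons (Var 2) (EHd (Var 4))) ?\<tau> \<in> set (rev (sym_list es))"
      show "exec_within (if_mem (ECons (Var 2) (ETl (Var 4))) 8 (Assign 9 (ECons ENil ENil)))
          \<rho> (46 * M\<^sup>2) (\<lambda>\<tau>. I (pre @ [d]) \<tau> \<and> \<tau> 3 = enc_list post)"
        by (rule exec_within_if_mem[where M = M and T = 6 and ds = "rev (sym_list es)"])
          (use I \<rho> mem d sz sz8 \<sigma> v Mpow in
            \<open>auto simp: I_def bool_data_def intro!: exec_within_Assign\<close>)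
    qed (use I d sz sz8 \<sigma> v Mpow in \<open>auto simp: I_def bool_data_def\<close>)
  qed (use sz in \<open>auto simp: I_def bool_data_def\<close>)
  have Q: "exec_within (for_each 3 4 body) (\<sigma>(9 := Leaf, 3 := enc_list es)) (94 * M ^ 3)
    (\<lambda>\<tau>. \<tau> 9 = bool_data (tri_test es (\<sigma> 2)) \<and>
      (\<forall>z. z \<notin> {3, 4, 5, 6, 7, 9, 13} \<longrightarrow> \<tau> z = \<sigma> z))"
  proof (rule exec_within_mono[OF loop])
    have "M * (86 * M\<^sup>2 + 8 * M) = 86 * M ^ 3 + 8 * M\<^sup>2"
      by (simp add: algebra_simps power2_eq_square power3_eq_cube)
    then show "M * (86 * M\<^sup>2 + 8 * M) \<le> 94 * M ^ 3"
      using Mpow by linarith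
  qed (auto simp: I_def tri_test_def)
  have "exec_within (Seq (Assign 3 (EHd (ETl (Var 0)))) (for_each 3 4 body)) (\<sigma>(9 := Leaf))
    (3 * M + 94 * M ^ 3) (\<lambda>\<tau>. \<tau> 9 = bool_data (tri_test es (\<sigma> 2)) \<and>
      (\<forall>z. z \<notin> {3, 4, 5, 6, 7, 9, 13} \<longrightarrow> \<tau> z = \<sigma> z))"
    by (rule exec_within_Assign_Seq[where T = "3 * M" and U = "94 * M ^ 3"]) (use Q sz \<sigma> in auto)
  then have "exec_within (Seq (Assign 3 (EHd (ETl (Var 0)))) (for_each 3 4 body))
    (\<sigma>(9 := eeval ENil \<sigma>)) (3 * M + 94 * M ^ 3) (\<lambda>\<tau>. \<tau> 9 = bool_data (tri_test es (\<sigma> 2)) \<and>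
      (\<forall>z. z \<notin> {3, 4, 5, 6, 7, 9, 13} \<longrightarrow> \<tau> z = \<sigma> z))"
    by simp
  then show ?thesis
    unfolding tri_prog_def body_def[symmetric]
    by (rule exec_within_Assign_Seq[where T = "2" and U = "3 * M + 94 * M ^ 3", rotated])
      (use Mpow sz in linarith, simp)
qed

section \<open>Filtering the vertices and the edges\<close>

definition vertex_prog :: prog where
  "vertex_prog = Seq (Assign 1 (EHd (Var 0))) (for_each 1 2
     (Seq tri_prog (Cond (Var 9) (Assign 10 (ECons (Var 2) (Var 10))) Skip)))"

text \<open>Every vertex costs one triangle test, cubic in \<open>M\<close>; the loop over fewer
  than \<open>M\<close> vertices yields degree 4, the degree of the whole program.\<close>

lemma exec_within_vertex_prog:
  assumes \<sigma>: "\<sigma> 0 = Node (enc_list vs) (Node (enc_list es) l)" "\<sigma> 8 = enc_list (rev (sym_list es))"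
    "\<sigma> 10 = Leaf"
    and M: "3 * dsize (\<sigma> 0) \<le> M" and es: "Leaf \<notin> set es"
  shows "exec_within vertex_prog \<sigma> (130 * M ^ 4)
    (\<lambda>\<tau>. \<tau> 10 = enc_list (rev (filter (tri_test es) vs)) \<and>
      (\<forall>z. z \<notin> {1, 2, 3, 4, 5, 6, 7, 9, 10, 13} \<longrightarrow> \<tau> z = \<sigma> z))"
proof -
  have sz: "3 * dsize (enc_list es) + 3 * dsize (enc_list vs) + 3 * dsize l + 6 \<le> M"
    using M \<sigma>(1) by simp
  have Mpow: "M \<le> M\<^sup>2" "M\<^sup>2 \<le> M ^ 3" "M ^ 3 \<le> M ^ 4"
    using sz by (simp_all add: power2_eq_square power3_eq_cube power4_eq_xxxx)
  let ?X = "{1, 2, 3, 4, 5, 6, 7, 9, 10, 13}"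
  define I where "I = (\<lambda>pre \<tau>. \<tau> 10 = enc_list (rev (filter (tri_test es) pre)) \<and>
      (\<forall>z. z \<notin> ?X \<longrightarrow> \<tau> z = \<sigma> z))"
  have loop: "exec_within (for_each 1 2 (Seq tri_prog (Cond (Var 9) (Assign 10 (ECons (Var 2) (Var 10))) Skip)))
      (\<sigma>(1 := enc_list vs)) (M * (110 * M ^ 3 + 8 * M)) (I vs)"
  proof (rule exec_within_for_each[where ds = vs and M = M and T = "110 * M ^ 3" and I = I])
    fix pre d post \<tau>
    assume ds: "vs = pre @ d # post" and I: "I pre \<tau>"
    let ?\<tau> = "\<tau>(2 := d, 1 := enc_list post)"
    have d: "dsize d < dsize (enc_list vs)"
      using dsize_enc_list_mem[of d vs] ds by simp
    \<comment> \<open>The list of kept vertices never outgrows the input list, so extending it stays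
      linear in \<open>M\<close>.\<close>
    have acc: "dsize (enc_list (rev (filter (tri_test es) pre))) \<le> dsize (enc_list vs)"
      using dsize_enc_list_append[of pre "d # post"] ds
        dsize_enc_list_filter[of "tri_test es" pre] by (simp add: dsize_enc_list_rev)
    have "exec_within tri_prog ?\<tau> (100 * M ^ 3) (\<lambda>\<rho>. \<rho> 9 = bool_data (tri_test es (?\<tau> 2)) \<and>
        (\<forall>z. z \<notin> {3, 4, 5, 6, 7, 9, 13} \<longrightarrow> \<rho> z = ?\<tau> z))"
      by (rule exec_within_tri_prog[where V = "enc_list vs" and l = l])
        (use I \<sigma> M es d in \<open>auto simp: I_def\<close>)
    then show "exec_within (Seq tri_prog (Cond (Var 9) (Assign 10 (ECons (Var 2) (Var 10))) Skip))
      ?\<tau> (110 * M ^ 3) (\<lambda>\<rho>. I (pre @ [d]) \<rho> \<and> \<rho> 1 = enc_list post)"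
    proof (rule exec_within_Seq[where U = "4 + 3 * M"])
      fix \<rho>
      assume \<rho>: "\<rho> 9 = bool_data (tri_test es (?\<tau> 2)) \<and>
        (\<forall>z. z \<notin> {3, 4, 5, 6, 7, 9, 13} \<longrightarrow> \<rho> z = ?\<tau> z)"
      have "exec_within (Assign 10 (ECons (Var 2) (Var 10))) \<rho> (3 * M)
          (\<lambda>\<rho>. I (pre @ [d]) \<rho> \<and> \<rho> 1 = enc_list post)" if "tri_test es d"
        by (rule exec_within_Assign) (use that \<rho> I d acc sz in \<open>auto simp: I_def\<close>)
      moreover have "exec_within Skip \<rho> (3 * M)
          (\<lambda>\<rho>. I (pre @ [d]) \<rho> \<and> \<rho> 1 = enc_list post)" if "\<not> tri_test es d"
        by (rule exec_within_Skip) (use that \<rho> I d acc sz in \<open>auto simp: I_def\<close>)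
      ultimately show "exec_within (Cond (Var 9) (Assign 10 (ECons (Var 2) (Var 10))) Skip) \<rho>
          (4 + 3 * M) (\<lambda>\<rho>. I (pre @ [d]) \<rho> \<and> \<rho> 1 = enc_list post)"
        by (intro exec_within_Cond[where T = "3 * M" and U = 4])
          (use \<rho> in \<open>auto simp: bool_data_def split: if_splits\<close>)
    qed (use Mpow sz in linarith)
  qed (use sz \<sigma> in \<open>auto simp: I_def\<close>)
  have "M * (110 * M ^ 3 + 8 * M) = 110 * M ^ 4 + 8 * M\<^sup>2"
    by (simp add: algebra_simps power2_eq_square power3_eq_cube power4_eq_xxxx)
  then have time: "3 * M + M * (110 * M ^ 3 + 8 * M) \<le> 130 * M ^ 4"
    using Mpow by linarith
  show ?thesis
    unfolding vertex_prog_def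
  proof (rule exec_within_mono[OF exec_within_Assign_Seq[where T = "3 * M"] time])
    show "exec_within (for_each 1 2 (Seq tri_prog (Cond (Var 9) (Assign 10 (ECons (Var 2) (Var 10))) Skip)))
      (\<sigma>(1 := eeval (EHd (Var 0)) \<sigma>)) (M * (110 * M ^ 3 + 8 * M)) (I vs)"
      using loop \<sigma> by simp
  qed (use \<sigma> sz in \<open>auto simp: I_def\<close>)
qed

definition edge_prog :: prog where
  "edge_prog = Seq (Assign 3 (EHd (ETl (Var 0)))) (for_each 3 4
     (if_mem (EHd (Var 4)) 10 (if_mem (ETl (Var 4)) 10 (Assign 11 (ECons (Var 4) (Var 11))))))"

text \<open>Bounding \<open>ws\<close> by \<open>V\<close> keeps each lookup among the kept vertices
  within \<open>M\<close>, so the two lookups per edge cost the same as in the triangle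
  test.\<close>

lemma exec_within_edge_prog:
  assumes \<sigma>: "\<sigma> 0 = Node V (Node (enc_list es) l)" "\<sigma> 10 = enc_list ws" "\<sigma> 11 = Leaf"
    and M: "3 * dsize (\<sigma> 0) \<le> M" and ws: "dsize (enc_list ws) \<le> dsize V"
  shows "exec_within edge_prog \<sigma> (130 * M ^ 3)
    (\<lambda>\<tau>. \<tau> 11 = enc_list (rev (filter (\<lambda>e. dhd e \<in> set ws \<and> dtl e \<in> set ws) es)) \<and>
      (\<forall>z. z \<notin> {3, 4, 5, 6, 7, 11, 13} \<longrightarrow> \<tau> z = \<sigma> z))"
proof -
  have sz: "3 * dsize (enc_list es) + 3 * dsize V + 3 * dsize l + 6 \<le> M"
    using M \<sigma>(1) by simp
  have Mpow: "M \<le> M\<^sup>2" "M\<^sup>2 \<le> M ^ 3"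
    using sz by (simp_all add: power2_eq_square power3_eq_cube)
  let ?P = "\<lambda>e. dhd e \<in> set ws \<and> dtl e \<in> set ws"
  let ?X = "{3, 4, 5, 6, 7, 11, 13}"
  define body where "body = if_mem (EHd (Var 4)) 10 (if_mem (ETl (Var 4)) 10
    (Assign 11 (ECons (Var 4) (Var 11))))"
  define I where "I = (\<lambda>pre \<tau>. \<tau> 11 = enc_list (rev (filter ?P pre)) \<and> (\<forall>z. z \<notin> ?X \<longrightarrow> \<tau> z = \<sigma> z))"
  have loop: "exec_within (for_each 3 4 body) (\<sigma>(3 := enc_list es)) (M * (86 * M\<^sup>2 + 8 * M)) (I es)"
  proof (rule exec_within_for_each[where ds = es and M = M and T = "86 * M\<^sup>2" and I = I])
    fix pre d post \<tau>
    assume ds: "es = pre @ d # post" and I: "I pre \<tau>"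
    let ?\<tau> = "\<tau>(4 := d, 3 := enc_list post)"
    have d: "dsize d < dsize (enc_list es)" "dsize (dhd d) \<le> dsize d" "dsize (dtl d) \<le> dsize d"
      using dsize_enc_list_mem[of d es] ds by (auto simp: dsize_dhd dsize_dtl)
    have acc: "dsize (enc_list (rev (filter ?P pre))) \<le> dsize (enc_list es)"
      using dsize_enc_list_append[of pre "d # post"] ds
        dsize_enc_list_filter[of ?P pre] by (simp add: dsize_enc_list_rev)
    show "exec_within body ?\<tau> (86 * M\<^sup>2) (\<lambda>\<tau>. I (pre @ [d]) \<tau> \<and> \<tau> 3 = enc_list post)"
      unfolding body_def
    proof (rule exec_within_if_mem[where M = M and T = "46 * M\<^sup>2" and ds = ws])
      fix \<rho>
      assume \<rho>: "\<forall>z. z \<notin> {5, 6, 7, 13} \<longrightarrow> \<rho> z = ?\<tau> z"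
        and mem: "eeval (EHd (Var 4)) ?\<tau> \<in> set ws"
      show "exec_within (if_mem (ETl (Var 4)) 10 (Assign 11 (ECons (Var 4) (Var 11))))
          \<rho> (46 * M\<^sup>2) (\<lambda>\<tau>. I (pre @ [d]) \<tau> \<and> \<tau> 3 = enc_list post)"
        by (rule exec_within_if_mem[where M = M and T = "3 * M" and ds = ws])
          (use I \<rho> mem d sz acc ws \<sigma> Mpow in \<open>auto simp: I_def intro!: exec_within_Assign\<close>)
    qed (use I d sz ws \<sigma> Mpow in \<open>auto simp: I_def\<close>)
  qed (use sz \<sigma> in \<open>auto simp: I_def\<close>)
  have "M * (86 * M\<^sup>2 + 8 * M) = 86 * M ^ 3 + 8 * M\<^sup>2"
    by (simp add: algebra_simps power2_eq_square power3_eq_cube)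
  then have time: "3 * M + M * (86 * M\<^sup>2 + 8 * M) \<le> 130 * M ^ 3"
    using Mpow by linarith
  show ?thesis
    unfolding edge_prog_def body_def[symmetric]
  proof (rule exec_within_mono[OF exec_within_Assign_Seq[where T = "3 * M"] time])
    show "exec_within (for_each 3 4 body) (\<sigma>(3 := eeval (EHd (ETl (Var 0))) \<sigma>))
      (M * (86 * M\<^sup>2 + 8 * M)) (I es)"
      using loop \<sigma> by simp
  qed (use \<sigma> sz in \<open>auto simp: I_def\<close>)
qed

definition kernel_prog :: prog where
  "kernel_prog = Seq sym_prog (Seq vertex_prog (Seq edge_prog
     (Assign 0 (ECons (Var 10) (ECons (Var 11) (ETl (ETl (Var 0))))))))"

text \<open>The entries are arbitrary trees, since the program only compares and copies them; that
  they encode a graph enters later. Edge entries are nodes so that the symmetric list stays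
  small.\<close>

lemma runs_kernel_prog:
  fixes vs es :: "data list" and l :: data
  defines "x \<equiv> Node (enc_list vs) (Node (enc_list es) l)"
    and "ws \<equiv> rev (filter (tri_test es) vs)"
  assumes es: "Leaf \<notin> set es"
  shows "\<exists>t. t \<le> 300 * (3 * dsize x) ^ 4 \<and> runs kernel_prog x t (Node (enc_list ws)
    (Node (enc_list (rev (filter (\<lambda>e. dhd e \<in> set ws \<and> dtl e \<in> set ws) es))) l))"
proof -
  define M where "M = 3 * dsize x"
  let ?es = "rev (filter (\<lambda>e. dhd e \<in> set ws \<and> dtl e \<in> set ws) es)"
  let ?\<sigma> = "(\<lambda>_ :: nat. Leaf)(0 := x)"
  have sz: "3 * dsize (enc_list es) + 3 * dsize (enc_list vs) + 3 * dsize l + 6 \<le> M"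
    by (simp add: M_def x_def)
  have Mpow: "M \<le> M\<^sup>2" "M\<^sup>2 \<le> M ^ 3" "M ^ 3 \<le> M ^ 4"
    using sz by (simp_all add: power2_eq_square power3_eq_cube power4_eq_xxxx)
  have ws: "dsize (enc_list ws) \<le> dsize (enc_list vs)"
    using dsize_enc_list_filter by (simp add: ws_def dsize_enc_list_rev)
  have es': "dsize (enc_list ?es) \<le> dsize (enc_list es)"
    using dsize_enc_list_filter by (simp add: dsize_enc_list_rev)
  have "exec_within kernel_prog ?\<sigma>
      (30 * M\<^sup>2 + (130 * M ^ 4 + (130 * M ^ 3 + 4 * M))) (\<lambda>\<tau>. \<tau> 0 = Node (enc_list ws) (Node (enc_list ?es) l))"
    unfolding kernel_prog_def
  proof (rule exec_within_Seq[OF exec_within_sym_prog[where V = "enc_list vs" and es = es and l = l and M = M]])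
    fix \<tau>
    assume \<tau>: "\<tau> 8 = enc_list (rev (sym_list es)) \<and> (\<forall>z. z \<notin> {3, 4, 8} \<longrightarrow> \<tau> z = ?\<sigma> z)"
    show "exec_within (Seq vertex_prog (Seq edge_prog
       (Assign 0 (ECons (Var 10) (ECons (Var 11) (ETl (ETl (Var 0)))))))) \<tau>
       (130 * M ^ 4 + (130 * M ^ 3 + 4 * M)) (\<lambda>\<tau>. \<tau> 0 = Node (enc_list ws) (Node (enc_list ?es) l))"
    proof (rule exec_within_Seq[OF exec_within_vertex_prog[where vs = vs and es = es and l = l and M = M]])
      fix \<rho>
      assume \<rho>: "\<rho> 10 = enc_list (rev (filter (tri_test es) vs)) \<and>
        (\<forall>z. z \<notin> {1, 2, 3, 4, 5, 6, 7, 9, 10, 13} \<longrightarrow> \<rho> z = \<tau> z)"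
      show "exec_within (Seq edge_prog (Assign 0 (ECons (Var 10) (ECons (Var 11) (ETl (ETl (Var 0)))))))
        \<rho> (130 * M ^ 3 + 4 * M) (\<lambda>\<tau>. \<tau> 0 = Node (enc_list ws) (Node (enc_list ?es) l))"
      proof (rule exec_within_Seq[OF exec_within_edge_prog
            [where V = "enc_list vs" and es = es and l = l and M = M and ws = ws]])
        fix \<pi>
        assume \<pi>: "\<pi> 11 = enc_list ?es \<and> (\<forall>z. z \<notin> {3, 4, 5, 6, 7, 11, 13} \<longrightarrow> \<pi> z = \<rho> z)"
        show "exec_within (Assign 0 (ECons (Var 10) (ECons (Var 11) (ETl (ETl (Var 0)))))) \<pi> (4 * M)
            (\<lambda>\<tau>. \<tau> 0 = Node (enc_list ws) (Node (enc_list ?es) l))"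
          by (rule exec_within_Assign) (use \<tau> \<rho> \<pi> sz ws es' in \<open>auto simp: x_def ws_def\<close>)
      qed (use \<tau> \<rho> ws in \<open>auto simp: ws_def x_def M_def\<close>)
    qed (use \<tau> es in \<open>auto simp: x_def M_def\<close>)
  qed (use es in \<open>auto simp: x_def M_def\<close>)
  \<comment> \<open>With all powers raised to the fourth, the coefficients add up to 30 + 130 + 130
    + 4 = 294.\<close>
  moreover have "30 * M\<^sup>2 + (130 * M ^ 4 + (130 * M ^ 3 + 4 * M)) \<le> 300 * M ^ 4"
    using Mpow by linarith
  ultimately show ?thesis
    unfolding exec_within_def runs_def M_def[symmetric] by (meson le_trans)
qed

section \<open>The kernel\<close>

text \<open>\<open>swap_data\<close> exchanges the ends of an encoded edge and
  \<open>enc_edge\<close> is injective, so the lookup succeeds iff one of the two orientations is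
  listed.\<close>

lemma Node_enc_mem_sym_list:
  assumes "(\<lambda>(u, v). {u, v}) ` set es = edges G"
  shows "Node (enc_nat a) (enc_nat b) \<in> set (sym_list (map enc_edge es)) \<longleftrightarrow> {a, b} \<in> edges G"
proof -
  have "swap_data (enc_edge (u, v)) = enc_edge (v, u)" for u v
    by (simp add: swap_data_def enc_edge_def)
  moreover have "Node (enc_nat a) (enc_nat b) = enc_edge (a, b)"
    by (simp add: enc_edge_def)
  ultimately have "Node (enc_nat a) (enc_nat b) \<in> set (sym_list (map enc_edge es)) \<longleftrightarrow>
      (a, b) \<in> set es \<or> (b, a) \<in> set es"
    by (force simp: set_sym_list enc_edge_inject image_iff)
  also have "\<dots> \<longleftrightarrow> {a, b} \<in> (\<lambda>(u, v). {u, v}) ` set es"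
    by (force simp: doubleton_eq_iff)
  finally show ?thesis
    using assms by simp
qed

lemma tri_test_enc:
  assumes "(\<lambda>(u, v). {u, v}) ` set es = edges G"
  shows "tri_test (map enc_edge es) (enc_nat v) \<longleftrightarrow> in_triangle G v"
proof -
  have "tri_test (map enc_edge es) (enc_nat v) \<longleftrightarrow>
      (\<exists>(a, b)\<in>set es. {v, a} \<in> edges G \<and> {v, b} \<in> edges G)"
    unfolding tri_test_def
    by (auto simp: enc_edge_def Node_enc_mem_sym_list[OF assms] case_prod_beta)
  also have "\<dots> \<longleftrightarrow> in_triangle G v"
  proof
    assume "in_triangle G v"
    then obtain a b where "{a, b} \<in> edges G" "{v, a} \<in> edges G" "{v, b} \<in> edges G"
      by (auto simp: in_triangle_def)
    \<comment> \<open>The opposite side may be listed in either orientation; the remaining condition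
      is symmetric in \<open>a\<close> and \<open>b\<close>.\<close>
    moreover from this(1) have "(a, b) \<in> set es \<or> (b, a) \<in> set es"
      unfolding assms[symmetric] by (force simp: doubleton_eq_iff)
    ultimately show "\<exists>(a, b)\<in>set es. {v, a} \<in> edges G \<and> {v, b} \<in> edges G"
      by auto
  next
    assume "\<exists>(a, b)\<in>set es. {v, a} \<in> edges G \<and> {v, b} \<in> edges G"
    then obtain a b where "(a, b) \<in> set es" "{v, a} \<in> edges G" "{v, b} \<in> edges G"
      by blast
    moreover from this(1) have "{a, b} \<in> edges G"
      unfolding assms[symmetric] by force
    ultimately show "in_triangle G v"
      unfolding in_triangle_def by blast
  qed
  finally show ?thesis .
qed

lemma runs_kernel_prog_encodes:
  assumes G: "simple_graph G" and x: "encodes x G l"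
  shows "\<exists>t y. runs kernel_prog x t y \<and> t \<le> 300 * (3 * dsize x) ^ 4 \<and> encodes y (triangle_core G) l"
proof -
  obtain vs es where vs: "distinct vs" "set vs = verts G"
    and es: "distinct (map (\<lambda>(u, v). {u, v}) es)" "(\<lambda>(u, v). {u, v}) ` set es = edges G"
    and x: "x = Node (enc_list (map enc_nat vs)) (Node (enc_list (map enc_edge es)) (enc_int l))"
    using x unfolding encodes_def by blast
  let ?vs = "rev (filter (in_triangle G) vs)"
  let ?es = "rev (filter (\<lambda>(u, v). in_triangle G u \<and> in_triangle G v) es)"
  define ws where "ws = rev (filter (tri_test (map enc_edge es)) (map enc_nat vs))"
  have ws: "ws = map enc_nat ?vs"
    using tri_test_enc[OF es(2)] by (simp add: ws_def filter_map rev_map o_def)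
  \<comment> \<open>Ends of edges occur among the vertices, so for them occurring in
    \<open>ws\<close> amounts to \<open>in_triangle\<close>.\<close>
  have ends: "u \<in> verts G" "v \<in> verts G" if "(u, v) \<in> set es" for u v
    using that simple_graph_adjD[OF G, of u v] es(2) by force+
  have "dhd (enc_edge e) \<in> set ws \<and> dtl (enc_edge e) \<in> set ws \<longleftrightarrow>
      (case e of (u, v) \<Rightarrow> in_triangle G u \<and> in_triangle G v)" if "e \<in> set es" for e
    using that ends[of "fst e" "snd e"] vs(2)
    by (auto simp: ws enc_edge_def enc_nat_inject image_iff split: prod.split)
  then have "filter (\<lambda>e. dhd e \<in> set ws \<and> dtl e \<in> set ws) (map enc_edge es) =
      map enc_edge (filter (\<lambda>(u, v). in_triangle G u \<and> in_triangle G v) es)"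
    by (auto simp: filter_map o_def intro!: arg_cong[where f = "map enc_edge"] filter_cong)
  moreover have "Leaf \<notin> set (map enc_edge es)"
    by (auto simp: enc_edge_def)
  ultimately obtain t where t: "t \<le> 300 * (3 * dsize x) ^ 4" "runs kernel_prog x t
      (Node (enc_list (map enc_nat ?vs)) (Node (enc_list (map enc_edge ?es)) (enc_int l)))"
    using runs_kernel_prog[of "map enc_edge es" "map enc_nat vs" "enc_int l"]
    unfolding x ws_def[symmetric] ws by (auto simp: rev_map)
  have "(\<lambda>(u, v). {u, v}) ` set ?es = edges (triangle_core G)"
  proof -
    have "(\<lambda>(u, v). {u, v}) ` set ?es = {e \<in> (\<lambda>(u, v). {u, v}) ` set es. \<forall>v\<in>e. in_triangle G v}"
      by force
    also have "\<dots> = edges (triangle_core G)"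
      using G unfolding es(2) by (auto simp: triangle_core_def induced_def simple_graph_def)
    finally show ?thesis .
  qed
  moreover have "distinct (map (\<lambda>(u, v). {u, v}) ?es)"
    using es(1) by (simp add: rev_map[symmetric] distinct_map_filter)
  moreover have "distinct ?vs" "set ?vs = verts (triangle_core G)"
    using vs by (auto simp: triangle_core_def induced_def)
  ultimately have "encodes (Node (enc_list (map enc_nat ?vs))
      (Node (enc_list (map enc_edge ?es)) (enc_int l))) (triangle_core G) l"
    unfolding encodes_def by blast
  then show ?thesis
    using t by blast
qed

(* The edge bound is a natural number: for k = 0 the truncated 4 * k - 1 is 0,
   as the integer -1 bounds no number of edges. *)
theorem theorem2:
  fixes r s :: nat
  assumes "r \<ge> 1" and "s \<ge> 1"
  shows "admits_kernel (vertex_triangle_club r s) fes (\<lambda>k. 3 * k) (\<lambda>k. 4 * k - 1)"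
  unfolding admits_kernel_def
\<comment> \<open>The constant is 300 * 3 ^ 4 = 24300, where 3 is the ratio of \<open>M\<close> to
  the input size.\<close>
proof (rule exI[of _ kernel_prog], rule exI[of _ 24300], rule exI[of _ 4],
    intro allI impI, elim conjE)
  fix G :: "nat ugraph" and l x
  assume G: "simple_graph G" and x: "encodes x G l"
  obtain t y where "runs kernel_prog x t y" "t \<le> 300 * (3 * dsize x) ^ 4"
    "encodes y (triangle_core G) l"
    using runs_kernel_prog_encodes[OF G x] by blast
  moreover have "300 * (3 * dsize x) ^ 4 \<le> 24300 * dsize x ^ 4 + 24300"
    by (simp add: power_mult_distrib)
  moreover have "simple_graph (triangle_core G)"
    using G simple_graph_induced by (simp add: triangle_core_def)
  ultimately show "\<exists>t y G' l'. runs kernel_prog x t y \<and> t \<le> 24300 * dsize x ^ 4 + 24300 \<and>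
      simple_graph G' \<and> encodes y G' l' \<and>
      vertex_triangle_club r s G' l' = vertex_triangle_club r s G l \<and>
      card (verts G') \<le> 3 * fes G \<and> card (edges G') \<le> 4 * fes G - 1"
    using triangle_core_size[OF G] vertex_triangle_club_triangle_core[OF assms(1)]
    by (meson le_trans)
qed

end
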